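(* Consider a sequence of community detection problems indexed by $N\to\infty$ with parameters $n,p_0,p_1$ (depending on $N$) satisfying the standing assumptions of the context. If $$\frac{p_1-p_0}{\sqrt{p_0}}\,\frac{n^2}{N}\to\infty ,$$ then the total degree test is asymptotically powerful: with $W=\sum_{1\le i<j\le N}W_{i,j}$, there is a sequence of thresholds $t_N$ such that the test $T_N=\mathbf 1\{W\ge t_N\}$ satisfies $\gamma_N(T_N)\to0$.
   Context: Observed data: the adjacency matrix $\boldsymbol{W}=(W_{i,j})\in\{0,1\}^{N\times N}$ (symmetric, zero diagonal) of a random undirected graph on the node set $\{1,\dots,N\}$. Let $0<p_0<p_1\le 1$. Under $\mathbb{P}_0$ (null), the $W_{i,j}$, $i<j$, are i.i.d. Bernoulli$(p_0)$. For $S\subset\{1,\dots,N\}$ with $|S|=n$, under $\mathbb{P}_S$ (alternative), the $W_{i,j}$, $i<j$, are independent, $\mathbb{P}_S(W_{i,j}=1)=p_1$ if $i,j\in S$, and $=p_0$ otherwise. A test $T$ is a function of $\boldsymbol{W}$ with values in $\{0,1\}$ (it may depend on $N,n,p_0,p_1$), and its risk is $\gamma_N(T)=\mathbb{P}_0(T=1)+\max_{|S|=n}\mathbb{P}_S(T=0)$. Standing assumptions: $N\to\infty$; $n,p_0,p_1$ may depend on $N$; $n/N\to0$; $p_0$ is bounded away from $1$; $N^2p_0\to\infty$; and $n\to\infty$ with $n^2p_1\to\infty$. *)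

theory Defs
  imports "HOL-Probability.Probability"
begin

definition node_pairs :: "nat \<Rightarrow> (nat \<times> nat) set" where
  "node_pairs N = {(i, j). 1 \<le> i \<and> i < j \<and> j \<le> N}"

type_synonym adj_matrix = "nat \<Rightarrow> nat \<Rightarrow> nat"

text \<open>
  The entries above the diagonal determine the matrix: it is symmetric with zero diagonal.
  In the laws below, entries with an index outside \<open>{1..N}\<close> are \<open>0\<close>, because the default
  value of the product distribution is \<open>False\<close>.
\<close>

definition symmetric_matrix :: "(nat \<times> nat \<Rightarrow> bool) \<Rightarrow> adj_matrix" where
  "symmetric_matrix w = (\<lambda>i j. if i < j then of_bool (w (i, j))
                               else if j < i then of_bool (w (j, i)) else 0)"

definition graph_pmf :: "nat \<Rightarrow> (nat \<Rightarrow> nat \<Rightarrow> real) \<Rightarrow> adj_matrix pmf" where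
  "graph_pmf N q = map_pmf symmetric_matrix
     (Pi_pmf (node_pairs N) False (\<lambda>(i, j). bernoulli_pmf (q i j)))"

definition null_pmf :: "nat \<Rightarrow> real \<Rightarrow> adj_matrix pmf" where
  "null_pmf N p0 = graph_pmf N (\<lambda>i j. p0)"

definition alt_pmf :: "nat \<Rightarrow> real \<Rightarrow> real \<Rightarrow> nat set \<Rightarrow> adj_matrix pmf" where
  "alt_pmf N p0 p1 S = graph_pmf N (\<lambda>i j. if i \<in> S \<and> j \<in> S then p1 else p0)"

text \<open>
  A test is a function of the adjacency matrix with values in \<open>{0, 1}\<close>.
  The maximum is meaningful only for \<open>n \<le> N\<close>, since otherwise it ranges over the empty set.
\<close>

definition risk :: "nat \<Rightarrow> nat \<Rightarrow> real \<Rightarrow> real \<Rightarrow> (adj_matrix \<Rightarrow> nat) \<Rightarrow> real" where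
  "risk N n p0 p1 T =
     measure_pmf.prob (null_pmf N p0) {W. T W = 1} +
     Max ((\<lambda>S. measure_pmf.prob (alt_pmf N p0 p1 S) {W. T W = 0}) `
            {S. S \<subseteq> {1..N} \<and> card S = n})"

definition total_degree :: "nat \<Rightarrow> adj_matrix \<Rightarrow> nat" where
  "total_degree N W = (\<Sum>(i, j)\<in>node_pairs N. W i j)"

definition total_degree_test :: "nat \<Rightarrow> real \<Rightarrow> adj_matrix \<Rightarrow> nat" where
  "total_degree_test N t W = (if real (total_degree N W) \<ge> t then 1 else 0)"

end

theory Submission
  imports Defs
begin

text \<open>
  Chebyshev's inequality suffices. The mean of the total degree is \<open>M p\<^sub>0\<close> under the null and
  \<open>M p\<^sub>0 + m (p\<^sub>1 - p\<^sub>0)\<close> under the alternative, where \<open>M\<close> and \<open>m\<close> are the numbers of pairs of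
  nodes in the graph and in the community; its variance is at most its mean. The threshold halfway
  between the means gives a risk of at most \<open>8 M p\<^sub>0 / \<Delta>\<^sup>2 + 4 / \<Delta>\<close> with \<open>\<Delta> = m (p\<^sub>1 - p\<^sub>0)\<close>. Up to constants
  the first term is the inverse square of the signal-to-noise ratio \<open>a\<close> of the hypothesis, and
  \<open>\<Delta>\<close> is at least of order \<open>a N sqrt p\<^sub>0\<close>, which also diverges.
\<close>

section \<open>Counting pairs of nodes\<close>

text \<open>A two-element set can be listed in increasing order in exactly one way. The count serves
  twice: for all nodes, with \<open>A = {1..N}\<close>, and for the community, with
  \<open>A = S\<close>.\<close>

lemma card_increasing_pairs:
  fixes A :: "'a :: linorder set"
  assumes "finite A"
  shows "card {(i, j). i \<in> A \<and> j \<in> A \<and> i < j} = card A choose 2"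
proof -
  have "bij_betw (\<lambda>(i, j). {i, j}) {(i, j). i \<in> A \<and> j \<in> A \<and> i < j} {B. B \<subseteq> A \<and> card B = 2}"
    unfolding bij_betw_def
  proof
    show "inj_on (\<lambda>(i, j). {i, j}) {(i, j). i \<in> A \<and> j \<in> A \<and> i < j}"
      by (auto simp: inj_on_def doubleton_eq_iff)
    show "(\<lambda>(i, j). {i, j}) ` {(i, j). i \<in> A \<and> j \<in> A \<and> i < j} = {B. B \<subseteq> A \<and> card B = 2}"
    proof (intro equalityI subsetI)
      fix B assume "B \<in> {B. B \<subseteq> A \<and> card B = 2}"
      then obtain i j where "B = {i, j}" "i \<noteq> j" "i \<in> A" "j \<in> A"
        by (auto simp: card_2_iff)
      then have "B = {min i j, max i j}" "min i j \<in> A" "max i j \<in> A" "min i j < max i j"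
        by (auto simp: min_def max_def)
      then show "B \<in> (\<lambda>(i, j). {i, j}) ` {(i, j). i \<in> A \<and> j \<in> A \<and> i < j}"
        by blast
    qed auto
  qed
  then have "card {(i, j). i \<in> A \<and> j \<in> A \<and> i < j} = card {B. B \<subseteq> A \<and> card B = 2}"
    by (rule bij_betw_same_card)
  also have "\<dots> = card A choose 2"
    by (rule n_subsets[OF assms])
  finally show ?thesis .
qed

lemma node_pairs_eq: "node_pairs N = {(i, j). i \<in> {1..N} \<and> j \<in> {1..N} \<and> i < j}"
  by (auto simp: node_pairs_def)

lemma finite_node_pairs [simp]: "finite (node_pairs N)"
  by (rule finite_subset[of _ "{1..N} \<times> {1..N}"]) (auto simp: node_pairs_def)

lemma card_node_pairs: "card (node_pairs N) = N choose 2"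
  unfolding node_pairs_eq by (subst card_increasing_pairs) auto

section \<open>Second moment of a sum of independent Bernoulli variables\<close>

lemma expectation_Pi_pmf_bernoulli:
  fixes f :: "bool \<Rightarrow> real"
  assumes "finite A" "e \<in> A" "0 \<le> q e" "q e \<le> 1"
  shows "measure_pmf.expectation (Pi_pmf A d (\<lambda>e. bernoulli_pmf (q e))) (\<lambda>w. f (w e)) =
    q e * f True + (1 - q e) * f False"
proof -
  have "measure_pmf.expectation (Pi_pmf A d (\<lambda>e. bernoulli_pmf (q e))) (\<lambda>w. f (w e)) =
    measure_pmf.expectation (map_pmf (\<lambda>w. w e) (Pi_pmf A d (\<lambda>e. bernoulli_pmf (q e)))) f"
    by simp
  also have "\<dots> = measure_pmf.expectation (bernoulli_pmf (q e)) f"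
    using assms by (simp add: Pi_pmf_component)
  also have "\<dots> = q e * f True + (1 - q e) * f False"
    using assms by simp
  finally show ?thesis .
qed

text \<open>The centred coordinates are independent with mean zero, so expanding the square leaves
  the diagonal terms, which are the Bernoulli variances.\<close>

lemma Pi_pmf_bernoulli_second_moment:
  assumes fin: "finite A" and q: "\<And>e. e \<in> A \<Longrightarrow> 0 \<le> q e \<and> q e \<le> 1"
  shows "measure_pmf.expectation (Pi_pmf A d (\<lambda>e. bernoulli_pmf (q e)))
    (\<lambda>w. ((\<Sum>e\<in>A. of_bool (w e)) - (\<Sum>e\<in>A. q e))\<^sup>2) = (\<Sum>e\<in>A. q e * (1 - q e))"
proof -
  define P where "P = Pi_pmf A d (\<lambda>e. bernoulli_pmf (q e))"
  define Y :: "'a \<Rightarrow> ('a \<Rightarrow> bool) \<Rightarrow> real" where "Y e w = of_bool (w e) - q e" for e w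
  \<comment> \<open>A product of finitely many Bernoulli laws has finite support, so every real
    function is integrable.\<close>
  have int: "integrable (measure_pmf P) f" for f :: "('a \<Rightarrow> bool) \<Rightarrow> real"
    unfolding P_def using fin
    by (intro integrable_measure_pmf_finite) (auto simp: set_Pi_pmf intro!: finite_PiE_dflt)
  have mean: "measure_pmf.expectation P (Y e) = 0" if "e \<in> A" for e
    using expectation_Pi_pmf_bernoulli[OF fin that, of q d "\<lambda>b. of_bool b - q e"] q[OF that]
    by (simp add: P_def Y_def[abs_def] algebra_simps)
  have var: "measure_pmf.expectation P (\<lambda>w. Y e w * Y e w) = q e * (1 - q e)" if "e \<in> A" for e
    using expectation_Pi_pmf_bernoulli[OF fin that, of q d "\<lambda>b. (of_bool b - q e) * (of_bool b - q e)"]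
      q[OF that]
    by (simp add: P_def Y_def[abs_def] algebra_simps)
  \<comment> \<open>The coordinates are independent under the product law, and \<open>Y e\<close>
    depends on coordinate \<open>e\<close> alone.\<close>
  have indep: "prob_space.indep_vars (measure_pmf P) (\<lambda>_. borel) Y A"
    unfolding Y_def[abs_def] P_def
    by (rule prob_space.indep_vars_compose2[OF _ indep_vars_Pi_pmf[OF fin],
          where Y = "\<lambda>e b. of_bool b - q e"]) (auto intro: measure_pmf.prob_space_axioms)
  have cov: "measure_pmf.expectation P (\<lambda>w. Y e w * Y e' w) = 0"
    if "e \<in> A" "e' \<in> A" "e \<noteq> e'" for e e'
  proof -
    have "prob_space.indep_vars (measure_pmf P) (\<lambda>_. borel) Y {e, e'}"
      using that by (intro prob_space.indep_vars_subset[OF measure_pmf.prob_space_axioms indep]) auto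
    then show ?thesis
      using prob_space.indep_vars_lebesgue_integral[OF measure_pmf.prob_space_axioms, of "{e, e'}" P Y]
        int mean that by simp
  qed
  have "measure_pmf.expectation P (\<lambda>w. ((\<Sum>e\<in>A. of_bool (w e)) - (\<Sum>e\<in>A. q e))\<^sup>2)
      = measure_pmf.expectation P (\<lambda>w. \<Sum>e\<in>A. \<Sum>e'\<in>A. Y e w * Y e' w)"
    by (simp only: Y_def power2_eq_square sum_product flip: sum_subtractf)
  also have "\<dots> = (\<Sum>e\<in>A. \<Sum>e'\<in>A. measure_pmf.expectation P (\<lambda>w. Y e w * Y e' w))"
    using int by (simp add: Bochner_Integration.integral_sum)
  also have "\<dots> = (\<Sum>e\<in>A. \<Sum>e'\<in>A. if e' = e then q e * (1 - q e) else 0)"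
    by (intro sum.cong refl) (auto simp: var cov)
  also have "\<dots> = (\<Sum>e\<in>A. q e * (1 - q e))"
    using fin by simp
  finally show ?thesis unfolding P_def .
qed

section \<open>Concentration and mean of the total degree\<close>

lemma total_degree_symmetric_matrix:
  "real (total_degree N (symmetric_matrix w)) = (\<Sum>e\<in>node_pairs N. of_bool (w e))"
  unfolding total_degree_def of_nat_sum
  by (rule sum.cong) (auto simp: symmetric_matrix_def node_pairs_def)

text \<open>Chebyshev's inequality, with the variance bounded by the mean since
  \<open>q * (1 - q) \<le> q\<close>. Allowing arbitrary edge probabilities covers the null and
  every alternative at once.\<close>

lemma total_degree_deviation:
  fixes q :: "nat \<Rightarrow> nat \<Rightarrow> real" and N :: nat
  assumes q: "\<And>i j. 0 \<le> q i j \<and> q i j \<le> 1" and "0 < a"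
  defines "\<mu> \<equiv> \<Sum>(i, j)\<in>node_pairs N. q i j"
  shows "measure_pmf.prob (graph_pmf N q) {W. a \<le> \<bar>real (total_degree N W) - \<mu>\<bar>} \<le> \<mu> / a\<^sup>2"
proof -
  define P where "P = Pi_pmf (node_pairs N) False (\<lambda>e. bernoulli_pmf (case_prod q e))"
  define X where "X w = (\<Sum>e\<in>node_pairs N. of_bool (w e)) - \<mu>" for w :: "nat \<times> nat \<Rightarrow> bool"
  have int: "integrable (measure_pmf P) f" for f :: "(nat \<times> nat \<Rightarrow> bool) \<Rightarrow> real"
    unfolding P_def
    by (intro integrable_measure_pmf_finite) (auto simp: set_Pi_pmf intro!: finite_PiE_dflt)
  have graph: "graph_pmf N q = map_pmf symmetric_matrix P"
    by (simp add: graph_pmf_def P_def case_prod_unfold)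
  have "measure_pmf.prob (graph_pmf N q) {W. a \<le> \<bar>real (total_degree N W) - \<mu>\<bar>}
      = measure_pmf.prob P {w \<in> space (measure_pmf P). a \<le> \<bar>X w\<bar>}"
    by (simp add: graph vimage_def total_degree_symmetric_matrix X_def)
  \<comment> \<open>\<open>X\<close> is already centred, so its second moment is the
    variance.\<close>
  also have "\<dots> \<le> measure_pmf.expectation P (\<lambda>w. (X w)\<^sup>2) / a\<^sup>2"
    using \<open>0 < a\<close> by (intro measure_pmf.second_moment_method int) simp_all
  also have "measure_pmf.expectation P (\<lambda>w. (X w)\<^sup>2) =
      (\<Sum>e\<in>node_pairs N. case_prod q e * (1 - case_prod q e))"
    unfolding X_def P_def \<mu>_def
    by (rule Pi_pmf_bernoulli_second_moment) (use q in auto)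
  also have "\<dots> \<le> \<mu>"
    unfolding \<mu>_def using q by (intro sum_mono) (auto intro!: mult_left_le)
  finally show ?thesis
    using \<open>0 < a\<close> by (simp add: divide_right_mono)
qed

text \<open>Every pair contributes \<open>p0\<close>, and each pair inside \<open>S\<close> adds the
  excess \<open>p1 - p0\<close>.\<close>

lemma sum_planted_probabilities:
  fixes p0 p1 :: real
  assumes S: "S \<subseteq> {1..N}"
  shows "(\<Sum>(i, j)\<in>node_pairs N. if i \<in> S \<and> j \<in> S then p1 else p0) =
    real (N choose 2) * p0 + real (card S choose 2) * (p1 - p0)"
proof -
  have "finite S"
    using S finite_subset by blast
  have "(\<Sum>(i, j)\<in>node_pairs N. if i \<in> S \<and> j \<in> S then p1 else p0) =
      (\<Sum>e\<in>node_pairs N. p0 + (if fst e \<in> S \<and> snd e \<in> S then p1 - p0 else 0))"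
    by (rule sum.cong) auto
  also have "\<dots> = real (N choose 2) * p0 +
      real (card (node_pairs N \<inter> {e. fst e \<in> S \<and> snd e \<in> S})) * (p1 - p0)"
    by (simp add: sum.distrib card_node_pairs sum.If_cases)
  \<comment> \<open>As \<open>S\<close> lies in \<open>{1..N}\<close>, every increasing pair from
    \<open>S\<close> is a node pair.\<close>
  also have "node_pairs N \<inter> {e. fst e \<in> S \<and> snd e \<in> S} = {(i, j). i \<in> S \<and> j \<in> S \<and> i < j}"
    using S by (auto simp: node_pairs_def)
  also have "card \<dots> = card S choose 2"
    by (rule card_increasing_pairs) fact
  finally show ?thesis .
qed

lemma real_choose_two: "real (k choose 2) = real k * (real k - 1) / 2"
  by (induction k) (simp_all add: numeral_2_eq_2 field_simps)

section \<open>Bounds on the risk\<close>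

text \<open>The lower half of the final sandwich. The assumption \<open>n \<le> N\<close> makes the
  family of communities nonempty, so that \<open>Max\<close> dominates a probability.\<close>

lemma risk_nonneg:
  assumes "n \<le> N"
  shows "0 \<le> risk N n p0 p1 T"
proof -
  have fin: "finite {S. S \<subseteq> {1..N} \<and> card S = n}"
    by simp
  have "{1..n} \<in> {S. S \<subseteq> {1..N} \<and> card S = n}"
    using assms by auto
  then have "measure_pmf.prob (alt_pmf N p0 p1 {1..n}) {W. T W = 0} \<le>
     Max ((\<lambda>S. measure_pmf.prob (alt_pmf N p0 p1 S) {W. T W = 0}) `
            {S. S \<subseteq> {1..N} \<and> card S = n})"
    using fin by (intro Max_ge finite_imageI imageI)
  then show ?thesis
    unfolding risk_def by (meson add_nonneg_nonneg measure_nonneg order_trans)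
qed

text \<open>Either kind of error forces the total degree at least \<open>\<Delta> / 2\<close> away
  from its mean. The two deviation bounds are \<open>4 * \<mu> / \<Delta>^2\<close> and
  \<open>4 * (\<mu> + \<Delta>) / \<Delta>^2\<close>; the second is the same for all
  \<open>S\<close>, hence also bounds the maximum.\<close>

lemma risk_total_degree_test_le:
  fixes p0 p1 :: real and n N :: nat
  assumes p: "0 \<le> p0" "p0 < p1" "p1 \<le> 1" and n: "2 \<le> n" "n \<le> N"
  defines "\<Delta> \<equiv> real (n choose 2) * (p1 - p0)"
  shows "risk N n p0 p1 (total_degree_test N (real (N choose 2) * p0 + \<Delta> / 2))
    \<le> 8 * (real (N choose 2) * p0) / \<Delta>\<^sup>2 + 4 / \<Delta>"
proof -
  define \<mu> where "\<mu> = real (N choose 2) * p0"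
  define T where "T = total_degree_test N (\<mu> + \<Delta> / 2)"
  \<comment> \<open>Here \<open>2 \<le> n\<close> matters: the community must contain at least one
    pair.\<close>
  have "0 < \<Delta>"
    using p n by (simp add: \<Delta>_def)
  have "measure_pmf.prob (null_pmf N p0) {W. T W = 1} \<le>
      measure_pmf.prob (null_pmf N p0) {W. \<Delta> / 2 \<le> \<bar>real (total_degree N W) - \<mu>\<bar>}"
    by (rule measure_pmf.finite_measure_mono) (auto simp: T_def total_degree_test_def abs_if)
  also have "\<dots> \<le> \<mu> / (\<Delta> / 2)\<^sup>2"
    using total_degree_deviation[of "\<lambda>i j. p0" "\<Delta> / 2" N] p \<open>0 < \<Delta>\<close>
    by (simp add: null_pmf_def card_node_pairs \<mu>_def)
  finally have null: "measure_pmf.prob (null_pmf N p0) {W. T W = 1} \<le> \<mu> / (\<Delta> / 2)\<^sup>2" .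
  have alt: "measure_pmf.prob (alt_pmf N p0 p1 S) {W. T W = 0} \<le> (\<mu> + \<Delta>) / (\<Delta> / 2)\<^sup>2"
    if S: "S \<subseteq> {1..N}" "card S = n" for S
  proof -
    define q where "q i j = (if i \<in> S \<and> j \<in> S then p1 else p0)" for i j
    have mean: "(\<Sum>(i, j)\<in>node_pairs N. q i j) = \<mu> + \<Delta>"
      using sum_planted_probabilities[OF S(1), of p1 p0] S(2) by (simp add: q_def \<mu>_def \<Delta>_def)
    \<comment> \<open>Accepting the null means a degree below \<open>\<mu> + \<Delta> / 2\<close>,
      which is more than \<open>\<Delta> / 2\<close> under the alternative mean
      \<open>\<mu> + \<Delta>\<close>.\<close>
    have "measure_pmf.prob (alt_pmf N p0 p1 S) {W. T W = 0} \<le>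
        measure_pmf.prob (graph_pmf N q) {W. \<Delta> / 2 \<le> \<bar>real (total_degree N W) - (\<mu> + \<Delta>)\<bar>}"
      unfolding alt_pmf_def q_def[abs_def]
      by (rule measure_pmf.finite_measure_mono)
        (auto simp: T_def total_degree_test_def abs_if split: if_splits)
    also have "\<dots> \<le> (\<mu> + \<Delta>) / (\<Delta> / 2)\<^sup>2"
      unfolding mean[symmetric]
      by (rule total_degree_deviation) (use p \<open>0 < \<Delta>\<close> in \<open>auto simp: q_def\<close>)
    finally show ?thesis .
  qed
  have "{1..n} \<in> {S. S \<subseteq> {1..N} \<and> card S = n}"
    using n by auto
  then have "{S. S \<subseteq> {1..N} \<and> card S = n} \<noteq> {}"
    by blast
  then have "Max ((\<lambda>S. measure_pmf.prob (alt_pmf N p0 p1 S) {W. T W = 0}) `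
      {S. S \<subseteq> {1..N} \<and> card S = n}) \<le> (\<mu> + \<Delta>) / (\<Delta> / 2)\<^sup>2"
    using alt by (intro Max.boundedI) auto
  with null have "risk N n p0 p1 T \<le> \<mu> / (\<Delta> / 2)\<^sup>2 + (\<mu> + \<Delta>) / (\<Delta> / 2)\<^sup>2"
    unfolding risk_def by linarith
  also have "\<dots> = 8 * \<mu> / \<Delta>\<^sup>2 + 4 / \<Delta>"
    using \<open>0 < \<Delta>\<close> by (simp add: field_simps power2_eq_square)
  finally show ?thesis
    by (simp add: T_def \<mu>_def)
qed

text \<open>The previous bound with binomial coefficients replaced by squares, which turns it into
  an expression in \<open>a\<close> and \<open>N^2 * p0\<close>, the two quantities assumed to
  diverge.\<close>

lemma risk_total_degree_test_le_snr:
  fixes p0 p1 :: real and n N :: nat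
  assumes p: "0 < p0" "p0 < p1" "p1 \<le> 1" and n: "2 \<le> n" "n \<le> N"
  defines "a \<equiv> (p1 - p0) / sqrt p0 * ((real n)\<^sup>2 / real N)"
  shows "risk N n p0 p1 (total_degree_test N
      (real (N choose 2) * p0 + real (n choose 2) * (p1 - p0) / 2))
    \<le> 64 / a\<^sup>2 + 16 / (a * sqrt ((real N)\<^sup>2 * p0))"
proof -
  define D where "D = (real n)\<^sup>2 * (p1 - p0)"
  define \<Delta> where "\<Delta> = real (n choose 2) * (p1 - p0)"
  have N: "0 < real N" and "0 < D"
    using n p by (auto simp: D_def)
  \<comment> \<open>Up to constants, \<open>D\<close> is the shift of the mean and
    \<open>sqrt (N^2 * p0)\<close> the square root of the variance bound under the null, so
    \<open>a\<close> is their ratio.\<close>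
  have aD: "a * sqrt ((real N)\<^sup>2 * p0) = D"
    using N p by (simp add: a_def D_def real_sqrt_mult)
  \<comment> \<open>For positive \<open>n\<close> this is equivalent to
    \<open>2 \<le> n\<close>.\<close>
  have "(real n)\<^sup>2 / 4 \<le> real n * (real n - 1) / 2"
    using n by (simp add: field_simps power2_eq_square)
  then have "D / 4 \<le> \<Delta>"
    using p mult_right_mono[of "(real n)\<^sup>2 / 4" "real (n choose 2)" "p1 - p0"]
    by (simp add: D_def \<Delta>_def real_choose_two)
  have "real (N choose 2) \<le> (real N)\<^sup>2 / 2"
    by (simp add: real_choose_two power2_eq_square field_simps)
  then have M: "real (N choose 2) * p0 \<le> (real N)\<^sup>2 * p0 / 2"
    using p mult_right_mono[of "real (N choose 2)" "(real N)\<^sup>2 / 2" p0] by simp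
  have "risk N n p0 p1 (total_degree_test N (real (N choose 2) * p0 + \<Delta> / 2))
      \<le> 8 * (real (N choose 2) * p0) / \<Delta>\<^sup>2 + 4 / \<Delta>"
    unfolding \<Delta>_def using p n by (intro risk_total_degree_test_le) auto
  also have "\<dots> \<le> 8 * ((real N)\<^sup>2 * p0 / 2) / (D / 4)\<^sup>2 + 4 / (D / 4)"
    using M \<open>D / 4 \<le> \<Delta>\<close> \<open>0 < D\<close> p
    by (intro add_mono frac_le power_mono) auto
  also have "8 * ((real N)\<^sup>2 * p0 / 2) / (D / 4)\<^sup>2 = 64 / a\<^sup>2"
    using N p \<open>0 < D\<close> by (simp add: power_mult_distrib power_divide flip: aD)
  finally show ?thesis
    by (simp add: aD \<Delta>_def)
qed

section \<open>Passage to the limit\<close>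

theorem proposition2:
  fixes n :: "nat \<Rightarrow> nat" and p0 p1 :: "nat \<Rightarrow> real"
  assumes "\<And>N. 0 < p0 N" and "\<And>N. p0 N < p1 N" and "\<And>N. p1 N \<le> 1"
    and "(\<lambda>N. real (n N) / real N) \<longlonglongrightarrow> 0"
    and "\<exists>c<1. \<forall>N. p0 N \<le> c"
    and "filterlim (\<lambda>N. (real N)\<^sup>2 * p0 N) at_top sequentially"
    and "filterlim n at_top sequentially"
    and "filterlim (\<lambda>N. (real (n N))\<^sup>2 * p1 N) at_top sequentially"
    and "filterlim (\<lambda>N. (p1 N - p0 N) / sqrt (p0 N) * ((real (n N))\<^sup>2 / real N)) at_top sequentially"
  shows "\<exists>t :: nat \<Rightarrow> real.
    (\<lambda>N. risk N (n N) (p0 N) (p1 N) (total_degree_test N (t N))) \<longlonglongrightarrow> 0"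
proof
  define a where "a N = (p1 N - p0 N) / sqrt (p0 N) * ((real (n N))\<^sup>2 / real N)" for N
  define t where "t N = real (N choose 2) * p0 N + real (n N choose 2) * (p1 N - p0 N) / 2" for N
  have a: "filterlim a at_top sequentially"
    using assms(9) by (simp add: a_def[abs_def])
  have s: "filterlim (\<lambda>N. sqrt ((real N)\<^sup>2 * p0 N)) at_top sequentially"
    by (rule filterlim_compose[OF sqrt_at_top assms(6)])
  have "eventually (\<lambda>N. real (n N) / real N < 1) sequentially"
    using order_tendstoD(2)[OF assms(4), of 1] by simp
  \<comment> \<open>Restricting to \<open>N > 0\<close> is necessary because division by zero yields
    \<open>0\<close>, so at \<open>N = 0\<close> the ratio would say nothing about
    \<open>n N\<close>.\<close>
  then have "eventually (\<lambda>N. n N \<le> N) sequentially"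
    using eventually_gt_at_top[of 0] by eventually_elim (simp add: field_simps)
  moreover have "eventually (\<lambda>N. 2 \<le> n N) sequentially"
    using assms(7) by (simp add: filterlim_at_top)
  ultimately have n: "eventually (\<lambda>N. 2 \<le> n N \<and> n N \<le> N) sequentially"
    by eventually_elim simp
  \<comment> \<open>Both denominators diverge, the second as a product of two diverging
    factors.\<close>
  have lim: "(\<lambda>N. 64 / (a N)\<^sup>2 + 16 / (a N * sqrt ((real N)\<^sup>2 * p0 N))) \<longlonglongrightarrow> 0"
    by (intro tendsto_add_zero tendsto_divide_0[OF tendsto_const] filterlim_at_top_imp_at_infinity
        filterlim_pow_at_top filterlim_at_top_mult_at_top a s) simp
  show "(\<lambda>N. risk N (n N) (p0 N) (p1 N) (total_degree_test N (t N))) \<longlonglongrightarrow> 0"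
  \<comment> \<open>The two bounds hold once \<open>2 \<le> n N\<close> and
    \<open>n N \<le> N\<close>, hence for all large \<open>N\<close>.\<close>
  proof (rule tendsto_sandwich[OF _ _ tendsto_const lim])
    show "eventually (\<lambda>N. 0 \<le> risk N (n N) (p0 N) (p1 N) (total_degree_test N (t N))) sequentially"
      using n by eventually_elim (simp add: risk_nonneg)
    show "eventually (\<lambda>N. risk N (n N) (p0 N) (p1 N) (total_degree_test N (t N))
        \<le> 64 / (a N)\<^sup>2 + 16 / (a N * sqrt ((real N)\<^sup>2 * p0 N))) sequentially"
      using n unfolding a_def t_def
      by eventually_elim (intro risk_total_degree_test_le_snr assms(1-3), auto)
  qed
qed

end
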